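(* Let $A_1,\dots,A_m\in\mathcal M_n(\mathbb C)$ be linearly independent and let $V=(V_1,\dots,V_m)$ be an $m$-tuple of complex $p\times q$ matrices. The following conditions are equivalent: (i) $\|\rho_V\|:=\sup\{\|\rho_V(f)\|:f\in\mathcal O(\Omega_{\mathbf A}),\ \|f\|_\infty\le1,\ f(0)=0\}\le1$; (ii) $\sup\{\|\rho_V(p^{(\alpha,\beta)}_{\mathbf A})\|:\alpha,\beta\in\mathbb C^n,\ \|\alpha\|=\|\beta\|=1\}\le1$; (iii) the linear map $L_V:(\mathbb C^m,\|\cdot\|^*_{\mathbf A})\to(\mathcal M_{p,q}(\mathbb C),\|\cdot\|_{\rm op})$ has norm at most $1$; (iv) $\sup_{\|\alpha\|=\|\beta\|=1}\|L_V(\langle A_1\alpha,\beta\rangle,\dots,\langle A_m\alpha,\beta\rangle)\|_{\rm op}\le1$, the supremum being over unit vectors $\alpha,\beta\in\mathbb C^n$.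
   Context: $\mathbf A=(A_1,\dots,A_m)$; $\|z\|_{\mathbf A}=\|z_1A_1+\cdots+z_mA_m\|_{\rm op}$ is a norm on $\mathbb C^m$ with open unit ball $\Omega_{\mathbf A}$, and $\|\cdot\|_{\mathbf A}^*$ is its dual norm on $\mathbb C^m$ with respect to the pairing $\sum_i\lambda_iz_i$. $p^{(\alpha,\beta)}_{\mathbf A}(z)=\langle(z_1A_1+\cdots+z_mA_m)\alpha,\beta\rangle$. $\mathcal O(\Omega_{\mathbf A})$ is the algebra of functions holomorphic in a neighbourhood of $\overline{\Omega_{\mathbf A}}$, with $\|f\|_\infty=\sup_{\Omega_{\mathbf A}}|f|$. The homomorphism $\rho_V:\mathcal O(\Omega_{\mathbf A})\to\mathcal M_{p+q}(\mathbb C)$ (at the point $0$) is $$\rho_V(f)=\begin{pmatrix}f(0)I_p&\sum_{i=1}^m\partial_if(0)V_i\\0&f(0)I_q\end{pmatrix},$$ and $L_V(z)=z_1V_1+\cdots+z_mV_m$. *)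

theory Defs
  imports "HOL-Analysis.Analysis"
begin

text \<open>
  A tuple \<open>(M\<^sub>1, \<dots>, M\<^sub>m)\<close> of complex \<open>r \<times> s\<close> matrices is a function \<open>M :: 'm \<Rightarrow> complex^'s^'r\<close> on a
  finite index type (the outer index of the matrix type counts rows). The Euclidean norm of
  \<open>\<complex>\<^sup>n\<close> is the library norm of \<open>complex^'n\<close>.
\<close>

definition pencil :: "('m::finite \<Rightarrow> complex^'s^'r) \<Rightarrow> complex^'m \<Rightarrow> complex^'s^'r" where
  "pencil M z = (\<chi> a b. \<Sum>i\<in>UNIV. z $ i * M i $ a $ b)"

definition lin_indep :: "('m::finite \<Rightarrow> complex^'s^'r) \<Rightarrow> bool" where
  "lin_indep M \<longleftrightarrow> (\<forall>z. pencil M z = 0 \<longrightarrow> (\<forall>i. z $ i = 0))"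

definition opnorm :: "complex^'s^'r \<Rightarrow> real" where
  "opnorm M = onorm (\<lambda>x. M *v x)"

text \<open>The library inner product on \<open>complex^'n\<close> is real valued; this is the Hermitian one.\<close>

definition hinner :: "complex^'n \<Rightarrow> complex^'n \<Rightarrow> complex" where
  "hinner x y = (\<Sum>j\<in>UNIV. x $ j * cnj (y $ j))"

definition normA :: "('m::finite \<Rightarrow> complex^'n^'n) \<Rightarrow> complex^'m \<Rightarrow> real" where
  "normA A z = opnorm (pencil A z)"

definition Omega :: "('m::finite \<Rightarrow> complex^'n^'n) \<Rightarrow> (complex^'m) set" where
  "Omega A = {z. normA A z < 1}"

text \<open>
  The pairing is bilinear, without conjugation. If \<open>A\<close> is linearly independent, the closed unit
  ball of \<open>normA A\<close> is compact, so that the real supremum is a genuine one.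
\<close>

definition dual_normA :: "('m::finite \<Rightarrow> complex^'n^'n) \<Rightarrow> complex^'m \<Rightarrow> real" where
  "dual_normA A l = (SUP z\<in>{z. normA A z \<le> 1}. cmod (\<Sum>i\<in>UNIV. l $ i * z $ i))"

text \<open>
  The remaining suprema are taken in \<^typ>\<open>ereal\<close>, so that a bound on them carries no
  implicit boundedness hypothesis.
\<close>

definition linmap_norm :: "(complex^'m \<Rightarrow> real) \<Rightarrow> (complex^'m::finite \<Rightarrow> complex^'s^'r) \<Rightarrow> ereal" where
  "linmap_norm N L = (SUP x\<in>{x. N x \<le> 1}. ereal (opnorm (L x)))"

text \<open>Holomorphy in several variables: the Frechet derivative exists and is complex linear.\<close>

definition mv_holomorphic_on :: "(complex^'m::finite \<Rightarrow> complex) \<Rightarrow> (complex^'m) set \<Rightarrow> bool" where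
  "mv_holomorphic_on f U \<longleftrightarrow>
     (\<forall>z\<in>U. \<exists>c::complex^'m. (f has_derivative (\<lambda>h. \<Sum>i\<in>UNIV. c $ i * h $ i)) (at z))"

definition O_alg :: "('m::finite \<Rightarrow> complex^'n^'n) \<Rightarrow> (complex^'m \<Rightarrow> complex) set" where
  "O_alg A = {f. \<exists>U. open U \<and> closure (Omega A) \<subseteq> U \<and> mv_holomorphic_on f U}"

definition supnorm :: "('m::finite \<Rightarrow> complex^'n^'n) \<Rightarrow> (complex^'m \<Rightarrow> complex) \<Rightarrow> ereal" where
  "supnorm A f = (SUP z\<in>Omega A. ereal (cmod (f z)))"

definition pderiv0 :: "(complex^'m::finite \<Rightarrow> complex) \<Rightarrow> 'm \<Rightarrow> complex" where
  "pderiv0 f i = deriv (\<lambda>t. f (axis i t)) 0"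

definition block_matrix ::
  "complex^'p^'p \<Rightarrow> complex^'q^'p \<Rightarrow> complex^'p^'q \<Rightarrow> complex^'q^'q
    \<Rightarrow> complex^('p::finite + 'q::finite)^('p + 'q)" where
  "block_matrix P Q R S =
     (\<chi> a b. case a of
         Inl i \<Rightarrow> (case b of Inl j \<Rightarrow> P $ i $ j | Inr j \<Rightarrow> Q $ i $ j)
       | Inr i \<Rightarrow> (case b of Inl j \<Rightarrow> R $ i $ j | Inr j \<Rightarrow> S $ i $ j))"

definition rho ::
  "('m::finite \<Rightarrow> complex^'q^'p) \<Rightarrow> (complex^'m \<Rightarrow> complex)
    \<Rightarrow> complex^('p::finite + 'q::finite)^('p + 'q)" where
  "rho V f = block_matrix (mat (f 0)) (pencil V (\<chi> i. pderiv0 f i)) 0 (mat (f 0))"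

definition rho_norm ::
  "('m::finite \<Rightarrow> complex^'n^'n) \<Rightarrow> ('m \<Rightarrow> complex^'q^'p) \<Rightarrow> ereal" where
  "rho_norm A V =
     (SUP f\<in>{f \<in> O_alg A. supnorm A f \<le> 1 \<and> f 0 = 0}. ereal (opnorm (rho V f)))"

definition pA ::
  "('m::finite \<Rightarrow> complex^'n^'n) \<Rightarrow> complex^'n \<Rightarrow> complex^'n \<Rightarrow> complex^'m \<Rightarrow> complex" where
  "pA A \<alpha> \<beta> z = hinner (pencil A z *v \<alpha>) \<beta>"

end

theory Submission
  imports Defs "HOL-Complex_Analysis.Cauchy_Integral_Formula"
begin

text \<open>
  On functions vanishing at \<open>0\<close>, \<open>\<parallel>\<rho>\<^sub>V(f)\<parallel> = \<parallel>L\<^sub>V(f'(0))\<parallel>\<close>, and the Cauchy inequality on complex lines through \<open>0\<close> puts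
  \<open>f'(0)\<close> in the dual unit ball. Hence (iii) implies (i), while (i) implies (ii), which is (iv),
  because the \<open>p\<^sub>A\<close> are linear. For (iv) implies (iii), let \<open>x\<close>, \<open>y\<close> be unit vectors and
  \<open>w\<^sub>i = \<langle>V\<^sub>i x, y\<rangle>\<close>: exchanging the roles of \<open>A\<close> and \<open>V\<close>, (iv) gives
  \<open>\<bar>\<langle>(\<Sum>w\<^sub>i A\<^sub>i) \<alpha>, \<beta>\<rangle>\<bar> \<le> 1\<close> for all unit \<open>\<alpha>\<close>, \<open>\<beta>\<close>, so \<open>w\<close> is in the unit ball of \<open>A\<close> and pairs with
  dual unit vectors to at most \<open>1\<close>.
\<close>

section \<open>Operator norm and the Hermitian form\<close>

lemma norm_mult_vec_le_opnorm:
  fixes M :: "complex^'s^'r"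
  shows "norm (M *v x) \<le> opnorm M * norm x"
  unfolding opnorm_def by (rule onorm) simp

lemma opnorm_nonneg: "0 \<le> opnorm (M :: complex^'s^'r)"
  unfolding opnorm_def by (rule onorm_pos_le) simp

lemma opnorm_le:
  fixes M :: "complex^'s^'r"
  assumes "\<And>x. norm (M *v x) \<le> c * norm x"
  shows "opnorm M \<le> c"
  unfolding opnorm_def using assms by (rule onorm_le)

lemma hinner_Cauchy_Schwarz: "cmod (hinner x y) \<le> norm x * norm y"
proof -
  have "cmod (hinner x y) \<le> (\<Sum>j\<in>UNIV. \<bar>norm (x $ j)\<bar> * \<bar>norm (y $ j)\<bar>)"
    unfolding hinner_def by (rule order_trans[OF norm_sum]) (simp add: norm_mult)
  also have "\<dots> \<le> norm x * norm y"
    unfolding norm_vec_def by (rule L2_set_mult_ineq)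
  finally show ?thesis .
qed

lemma hinner_self: "hinner x x = of_real ((norm x)\<^sup>2)"
  by (simp add: hinner_def norm_vec_def L2_set_def sum_nonneg complex_norm_square[symmetric])

lemma hinner_scaleR_left: "hinner (a *\<^sub>R x) y = of_real a * hinner x y"
  by (simp add: hinner_def sum_distrib_left scaleR_conv_of_real[where 'a = complex] mult_ac)

lemma hinner_scaleR_right: "hinner x (a *\<^sub>R y) = of_real a * hinner x y"
  by (simp add: hinner_def sum_distrib_left scaleR_conv_of_real[where 'a = complex] mult_ac)

lemma cmod_hinner_le_opnorm:
  assumes "norm x = 1" "norm y = 1"
  shows "cmod (hinner (M *v x) y) \<le> opnorm M"
  using hinner_Cauchy_Schwarz[of "M *v x" y] norm_mult_vec_le_opnorm[of M x] assms by simp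

text \<open>Testing \<open>M *v x\<close> against its own normalised direction recovers its full
  norm, so sesquilinear bounds on unit vectors control the operator norm. It serves for both
  \<open>A\<close> and \<open>V\<close>.\<close>

lemma opnorm_le_hinner:
  assumes "\<And>x y. norm x = 1 \<Longrightarrow> norm y = 1 \<Longrightarrow> cmod (hinner (M *v x) y) \<le> c" and "0 \<le> c"
  shows "opnorm M \<le> c"
proof (rule opnorm_le)
  fix x
  show "norm (M *v x) \<le> c * norm x"
  proof (cases "M *v x = 0")
    case True
    then show ?thesis using \<open>0 \<le> c\<close> by simp
  next
    case False
    then have "x \<noteq> 0" by auto
    define u where "u = (1 / norm x) *\<^sub>R x"
    have Mu: "M *v u = (1 / norm x) *\<^sub>R (M *v x)"
      unfolding u_def
      by (rule linear_scale[OF bounded_linear.linear[OF matrix_vector_mul_bounded_linear]])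
    have "cmod (hinner (M *v u) ((1 / norm (M *v x)) *\<^sub>R (M *v x))) \<le> c"
      by (rule assms(1)) (use False \<open>x \<noteq> 0\<close> in \<open>simp_all add: u_def\<close>)
    then show ?thesis
      using False \<open>x \<noteq> 0\<close>
      by (simp add: Mu hinner_scaleR_left hinner_scaleR_right hinner_self norm_mult norm_divide
          field_simps power2_eq_square)
  qed
qed

lemma cmod_entry_le_opnorm:
  fixes M :: "complex^'s^'r"
  shows "cmod (M $ a $ b) \<le> opnorm M"
proof -
  have "M $ a $ b = (M *v axis b 1) $ a"
    by (simp add: matrix_vector_mult_def axis_def if_distrib cong: if_cong)
  then have "cmod (M $ a $ b) \<le> norm (M *v axis b 1)"
    by (simp add: Finite_Cartesian_Product.norm_nth_le)
  also have "\<dots> \<le> opnorm M"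
    using norm_mult_vec_le_opnorm[of M "axis b 1"] by simp
  finally show ?thesis .
qed

text \<open>A crude comparison through the entries; any finite constant suffices to make the unit
  ball of \<open>normA\<close> bounded.\<close>

lemma norm_le_opnorm:
  fixes M :: "complex^'s^'r"
  shows "norm M \<le> real CARD('r) * (real CARD('s) * opnorm M)"
proof -
  have "norm (M $ a) \<le> real CARD('s) * opnorm M" for a
    using sum_bounded_above[of UNIV "\<lambda>b. cmod (M $ a $ b)", OF cmod_entry_le_opnorm]
      L2_set_le_sum[of UNIV "\<lambda>b. norm (M $ a $ b)"]
    by (simp add: norm_vec_def)
  then have "(\<Sum>a\<in>UNIV. norm (M $ a)) \<le> real CARD('r) * (real CARD('s) * opnorm M)"
    using sum_bounded_above[of UNIV "\<lambda>a. norm (M $ a)"] by simp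
  then show ?thesis
    using L2_set_le_sum[of UNIV "\<lambda>a. norm (M $ a)"] by (simp add: norm_vec_def)
qed

section \<open>The norm of a pencil and its dual\<close>

lemma hinner_pencil:
  "hinner (pencil M z *v x) y = (\<Sum>i\<in>UNIV. z $ i * hinner (M i *v x) y)"
proof -
  have "hinner (pencil M z *v x) y =
      (\<Sum>a\<in>UNIV. \<Sum>b\<in>UNIV. \<Sum>i\<in>UNIV. z $ i * (M i $ a $ b * x $ b * cnj (y $ a)))"
    by (simp add: hinner_def pencil_def matrix_vector_mult_def sum_distrib_right sum_distrib_left mult_ac)
  also have "\<dots> = (\<Sum>a\<in>UNIV. \<Sum>i\<in>UNIV. \<Sum>b\<in>UNIV. z $ i * (M i $ a $ b * x $ b * cnj (y $ a)))"
    by (intro sum.cong refl sum.swap)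
  also have "\<dots> = (\<Sum>i\<in>UNIV. \<Sum>a\<in>UNIV. \<Sum>b\<in>UNIV. z $ i * (M i $ a $ b * x $ b * cnj (y $ a)))"
    by (rule sum.swap)
  also have "\<dots> = (\<Sum>i\<in>UNIV. z $ i * hinner (M i *v x) y)"
    by (simp add: hinner_def matrix_vector_mult_def sum_distrib_right sum_distrib_left)
  finally show ?thesis .
qed

lemma linear_pencil: "linear (pencil M)"
  by (rule linearI)
    (simp_all add: pencil_def vec_eq_iff ring_distribs sum.distrib scaleR_sum_right)

lemma normA_smult: "normA A (t *s z) = cmod t * normA A z"
proof -
  have eq: "norm (pencil A (t *s z) *v x) = cmod t * norm (pencil A z *v x)" for t z x
  proof -
    have "pencil A (t *s z) *v x = t *s (pencil A z *v x)"
      by (simp add: vec_eq_iff pencil_def matrix_vector_mult_def sum_distrib_left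
          sum_distrib_right mult_ac)
    then show ?thesis
      by (simp add: norm_vec_def norm_mult L2_set_right_distrib)
  qed
  have le: "normA A (t *s z) \<le> cmod t * normA A z" for t z
    unfolding normA_def
    by (rule opnorm_le)
      (simp add: eq mult.assoc mult_left_mono norm_mult_vec_le_opnorm)
  \<comment> \<open>The reverse inequality is \<open>le\<close> itself, applied to the scalar
    \<open>inverse t\<close> and the vector \<open>t *s z\<close>.\<close>
  have "cmod t * normA A z \<le> normA A (t *s z)"
  proof (cases "t = 0")
    case True
    then show ?thesis by (simp add: normA_def opnorm_nonneg)
  next
    case False
    then have "normA A z \<le> inverse (cmod t) * normA A (t *s z)"
      using le[of "inverse t" "t *s z"] by (simp add: vector_smult_assoc norm_inverse)
    then have "cmod t * normA A z \<le> cmod t * (inverse (cmod t) * normA A (t *s z))"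
      by (rule mult_left_mono) simp
    also have "\<dots> = normA A (t *s z)"
      using False by simp
    finally show ?thesis .
  qed
  with le show ?thesis by (rule antisym)
qed

text \<open>Linear independence says that \<open>pencil A\<close> is injective, and an injective
  linear map in finite dimension is bounded below.\<close>

lemma bounded_normA_ball:
  assumes "lin_indep A"
  shows "bounded {z. normA A z \<le> 1}"
proof -
  have "inj (pencil A)"
    using assms linear_injective_0[OF linear_pencil[of A]]
    by (auto simp: lin_indep_def vec_eq_iff)
  then obtain B where "B > 0" and B: "\<And>z. B * norm z \<le> norm (pencil A z)"
    using linear_inj_bounded_below_pos[OF linear_pencil[of A]] by blast
  \<comment> \<open>The constant of \<open>norm_le_opnorm\<close> for square matrices.\<close>
  define K where "K = real CARD('b) * real CARD('b)"
  have "norm z \<le> K / B" if "normA A z \<le> 1" for z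
  proof -
    have "B * norm z \<le> K * opnorm (pencil A z)"
      using B[of z] norm_le_opnorm[of "pencil A z"] by (simp add: K_def)
    also have "\<dots> \<le> K * 1"
      using that by (intro mult_left_mono) (simp_all add: K_def normA_def)
    finally show ?thesis using \<open>B > 0\<close> by (simp add: field_simps)
  qed
  then show ?thesis by (auto simp: bounded_iff)
qed

text \<open>The bounded unit ball makes the pairings bounded above, so the real supremum in
  \<open>dual_normA\<close> really dominates each of them.\<close>

lemma cmod_pairing_le_dual_normA:
  assumes "lin_indep A" "normA A z \<le> 1"
  shows "cmod (\<Sum>i\<in>UNIV. l $ i * z $ i) \<le> dual_normA A l"
  unfolding dual_normA_def
proof (rule cSUP_upper)
  obtain K where K: "\<And>z. normA A z \<le> 1 \<Longrightarrow> norm z \<le> K"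
    using bounded_normA_ball[OF assms(1)] by (auto simp: bounded_iff)
  have "cmod (\<Sum>i\<in>UNIV. l $ i * z $ i) \<le> (\<Sum>i\<in>UNIV. cmod (l $ i) * K)" if "normA A z \<le> 1" for z
    by (rule sum_norm_le)
      (metis K that Finite_Cartesian_Product.norm_nth_le order_trans norm_mult mult_left_mono norm_ge_zero)
  then show "bdd_above ((\<lambda>z. cmod (\<Sum>i\<in>UNIV. l $ i * z $ i)) ` {z. normA A z \<le> 1})"
    by (auto intro!: bdd_aboveI2)
qed (use assms in simp)

lemma normA_0: "normA A 0 = 0"
  using normA_smult[of A 0 0] by simp

lemma dual_normA_le:
  assumes "\<And>z. normA A z \<le> 1 \<Longrightarrow> cmod (\<Sum>i\<in>UNIV. l $ i * z $ i) \<le> c"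
  shows "dual_normA A l \<le> c"
  unfolding dual_normA_def using assms normA_0[of A]
  by (intro cSUP_least) (auto intro: exI[of _ 0])

section \<open>The norm of \<open>rho\<close> on functions vanishing at the origin\<close>

lemma sum_UNIV_sum_type:
  fixes g :: "'p::finite + 'q::finite \<Rightarrow> 'a::comm_monoid_add"
  shows "sum g UNIV = (\<Sum>i\<in>UNIV. g (Inl i)) + (\<Sum>j\<in>UNIV. g (Inr j))"
  by (simp add: UNIV_Plus_UNIV[symmetric] sum.Plus del: UNIV_Plus_UNIV)

text \<open>The block matrix sees only the \<open>Inr\<close> coordinates, and dropping the others
  does not increase the norm. Conversely, extension by zero embeds the domain of \<open>Q\<close>
  isometrically.\<close>

lemma opnorm_block_matrix_upper_right:
  fixes Q :: "complex^'q::finite^'p::finite"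
  shows "opnorm (block_matrix 0 Q 0 0) = opnorm Q"
proof (rule antisym)
  have eq: "norm (block_matrix 0 Q 0 0 *v z) = norm (Q *v (\<chi> j. z $ Inr j))" for z
    by (simp add: norm_vec_def L2_set_def sum_UNIV_sum_type block_matrix_def
        matrix_vector_mult_def)
  show "opnorm (block_matrix 0 Q 0 0) \<le> opnorm Q"
  proof (rule opnorm_le)
    fix z :: "complex^('p + 'q)"
    have "norm (\<chi> j. z $ Inr j) \<le> norm z"
      by (simp add: norm_vec_def L2_set_def sum_UNIV_sum_type sum_nonneg)
    then have "opnorm Q * norm (\<chi> j. z $ Inr j) \<le> opnorm Q * norm z"
      by (intro mult_left_mono opnorm_nonneg)
    then show "norm (block_matrix 0 Q 0 0 *v z) \<le> opnorm Q * norm z"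
      unfolding eq by (rule order_trans[OF norm_mult_vec_le_opnorm])
  qed
  show "opnorm Q \<le> opnorm (block_matrix 0 Q 0 0 :: complex^('p + 'q)^('p + 'q))"
  proof (rule opnorm_le)
    fix x :: "complex^'q"
    define z :: "complex^('p + 'q)" where
      "z = (\<chi> a. case a of Inl i \<Rightarrow> 0 | Inr j \<Rightarrow> x $ j)"
    have "norm z = norm x"
      by (simp add: z_def norm_vec_def L2_set_def sum_UNIV_sum_type)
    moreover have "(\<chi> j. z $ Inr j) = x"
      by (simp add: z_def vec_eq_iff)
    ultimately show "norm (Q *v x) \<le> opnorm (block_matrix 0 Q 0 0 :: complex^('p + 'q)^('p + 'q)) * norm x"
      using norm_mult_vec_le_opnorm[of "block_matrix 0 Q 0 0" z] by (simp add: eq)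
  qed
qed

lemma opnorm_rho:
  assumes "f 0 = 0"
  shows "opnorm (rho V f) = opnorm (pencil V (\<chi> i. pderiv0 f i))"
proof -
  have "mat 0 = (0 :: complex^'k^'k)" by (simp add: mat_def vec_eq_iff)
  then show ?thesis
    using assms by (simp add: rho_def opnorm_block_matrix_upper_right)
qed

section \<open>Derivatives in several variables and the functions \<open>pA\<close>\<close>

lemma pA_eq: "pA A \<alpha> \<beta> z = (\<Sum>i\<in>UNIV. hinner (A i *v \<alpha>) \<beta> * z $ i)"
  by (simp add: pA_def hinner_pencil mult.commute)

lemma has_derivative_coefficients:
  "((\<lambda>z. \<Sum>i\<in>UNIV. c i * z $ i) has_derivative (\<lambda>h. \<Sum>i\<in>UNIV. c i * h $ i))
     (at (z :: complex^'m::finite))"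
  by (intro bounded_linear.has_derivative[OF _ has_derivative_ident]
      linear_conv_bounded_linear[THEN iffD1] linearI)
    (simp_all add: ring_distribs sum.distrib scaleR_sum_right)

text \<open>The chain rule along a complex line through the origin, which reduces several variables
  to one.\<close>

lemma has_field_derivative_along_line:
  fixes c :: "complex^'m::finite"
  assumes "(f has_derivative (\<lambda>h. \<Sum>i\<in>UNIV. c $ i * h $ i)) (at (t *s z))"
  shows "((\<lambda>t. f (t *s z)) has_field_derivative (\<Sum>i\<in>UNIV. c $ i * z $ i)) (at t)"
proof -
  have "((\<lambda>t. t *s z) has_derivative (\<lambda>t. t *s z)) (at t)"
    by (intro bounded_linear.has_derivative[OF _ has_derivative_ident]
        linear_conv_bounded_linear[THEN iffD1] linearI)
      (simp_all add: vec_eq_iff ring_distribs)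
  from has_derivative_compose[OF this assms]
  have "((\<lambda>t. f (t *s z)) has_derivative (\<lambda>h. \<Sum>i\<in>UNIV. c $ i * (h *s z) $ i)) (at t)" .
  moreover have "(\<lambda>h. \<Sum>i\<in>UNIV. c $ i * (h *s z) $ i) = (*) (\<Sum>i\<in>UNIV. c $ i * z $ i)"
    by (simp add: fun_eq_iff sum_distrib_left mult_ac)
  ultimately show ?thesis by (simp only: has_field_derivative_def)
qed

text \<open>The coordinate axis \<open>axis i t\<close> is the complex line spanned by
  \<open>axis i 1\<close>.\<close>

lemma pderiv0_eq:
  fixes c :: "complex^'m::finite"
  assumes "(f has_derivative (\<lambda>h. \<Sum>i\<in>UNIV. c $ i * h $ i)) (at 0)"
  shows "pderiv0 f i = c $ i"
proof -
  have axis: "(\<lambda>t. f (axis i t)) = (\<lambda>t. f (t *s axis i 1))"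
    by (intro ext arg_cong[where f = f]) (simp add: vec_eq_iff axis_def)
  have "(\<Sum>j\<in>UNIV. c $ j * axis i 1 $ j) = c $ i"
    by (simp add: axis_def if_distrib cong: if_cong)
  then show ?thesis
    using has_field_derivative_along_line[of f c 0 "axis i 1"] assms
    by (simp add: pderiv0_def axis DERIV_imp_deriv)
qed

lemma opnorm_rho_pA:
  "opnorm (rho V (pA A \<alpha> \<beta>)) = opnorm (pencil V (\<chi> i. hinner (A i *v \<alpha>) \<beta>))"
proof -
  have "(pA A \<alpha> \<beta> has_derivative
      (\<lambda>h. \<Sum>i\<in>UNIV. (\<chi> i. hinner (A i *v \<alpha>) \<beta>) $ i * h $ i)) (at 0)"
    using has_derivative_coefficients by (simp add: pA_eq[abs_def])
  from pderiv0_eq[OF this]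
  have "(\<chi> i. pderiv0 (pA A \<alpha> \<beta>) i) = (\<chi> i. hinner (A i *v \<alpha>) \<beta>)"
    by (simp add: vec_eq_iff)
  then show ?thesis
    by (subst opnorm_rho) (simp_all add: pA_eq)
qed

lemma cmod_pA_le:
  assumes "norm \<alpha> = 1" "norm \<beta> = 1"
  shows "cmod (pA A \<alpha> \<beta> z) \<le> normA A z"
  using cmod_hinner_le_opnorm[OF assms] by (simp add: pA_def normA_def)

lemma pA_in_O_alg: "pA A \<alpha> \<beta> \<in> O_alg A"
proof -
  have "\<exists>c::complex^'m. (pA A \<alpha> \<beta> has_derivative (\<lambda>h. \<Sum>i\<in>UNIV. c $ i * h $ i)) (at z)"
    for A :: "'m::finite \<Rightarrow> complex^'n^'n" and \<alpha> \<beta> z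
    using has_derivative_coefficients
    by (intro exI[of _ "\<chi> i. hinner (A i *v \<alpha>) \<beta>"]) (simp add: pA_eq[abs_def])
  then show ?thesis
    by (auto simp: O_alg_def mv_holomorphic_on_def intro!: exI[of _ UNIV])
qed

section \<open>The Cauchy inequality and the dual unit ball\<close>

lemma cmod_deriv_0_le_1:
  fixes g :: "complex \<Rightarrow> complex"
  assumes diff: "\<And>t. cmod t < 1 \<Longrightarrow> g field_differentiable at t"
    and bound: "\<And>t. cmod t < 1 \<Longrightarrow> cmod (g t) \<le> 1"
  shows "cmod (deriv g 0) \<le> 1"
proof -
  \<comment> \<open>The hypotheses reach only the open disc, so Cauchy's inequality is used at
    radius \<open>r\<close> below 1; letting \<open>r\<close> tend to 1 finishes.\<close>
  have "r * cmod (deriv g 0) \<le> 1" if r: "0 < r" "r < 1" for r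
  proof -
    have hol: "g holomorphic_on ball 0 1"
      using diff by (simp add: holomorphic_on_open field_differentiable_def)
    then have "g holomorphic_on ball 0 r"
      by (rule holomorphic_on_subset) (use r in auto)
    moreover have "continuous_on (cball 0 r) g"
      using holomorphic_on_imp_continuous_on[OF hol]
      by (rule continuous_on_subset) (use r in auto)
    ultimately have "cmod ((deriv ^^ 1) g 0) \<le> fact 1 * 1 / r ^ 1"
      using r bound by (intro Cauchy_inequality) auto
    then show ?thesis using r by (simp add: field_simps)
  qed
  then show ?thesis by (rule field_le_mult_one_interval)
qed

text \<open>For \<open>z\<close> in the closed unit ball, \<open>t *s z\<close> stays in
  \<open>Omega A\<close> while \<open>cmod t < 1\<close>. The one-variable bound then applies to
  \<open>f\<close> on this line, where the derivative at 0 is the pairing of the gradient with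
  \<open>z\<close>.\<close>

lemma dual_normA_derivative_le:
  fixes f :: "complex^'m::finite \<Rightarrow> complex"
  assumes "f \<in> O_alg A" "supnorm A f \<le> 1"
  shows "dual_normA A (\<chi> i. pderiv0 f i) \<le> 1"
proof (rule dual_normA_le)
  fix z assume z: "normA A z \<le> 1"
  obtain U where U: "closure (Omega A) \<subseteq> U" "mv_holomorphic_on f U"
    using assms(1) by (auto simp: O_alg_def)
  have deriv: "\<exists>c::complex^'m. (f has_derivative (\<lambda>h. \<Sum>i\<in>UNIV. c $ i * h $ i)) (at w)"
    if "w \<in> Omega A" for w
    using that U closure_subset[of "Omega A"] unfolding mv_holomorphic_on_def by blast
  have bound: "cmod (f w) \<le> 1" if "w \<in> Omega A" for w
    using SUP_upper[of w "Omega A" "\<lambda>z. ereal (cmod (f z))"] that assms(2)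
    by (simp add: supnorm_def SUP_le_iff)
  have line: "t *s z \<in> Omega A" if "cmod t < 1" for t
  proof -
    have "cmod t * normA A z \<le> cmod t" using z by (simp add: mult_left_le)
    then show ?thesis using that by (simp add: Omega_def normA_smult)
  qed
  have diff: "(\<lambda>t. f (t *s z)) field_differentiable at t" if "cmod t < 1" for t
    using deriv[OF line[OF that]] has_field_derivative_along_line
    unfolding field_differentiable_def by blast
  obtain c :: "complex^'m" where c: "(f has_derivative (\<lambda>h. \<Sum>i\<in>UNIV. c $ i * h $ i)) (at 0)"
    using deriv[of 0] by (auto simp: Omega_def normA_0)
  define d where "d = (\<Sum>i\<in>UNIV. c $ i * z $ i)"
  have "deriv (\<lambda>t. f (t *s z)) 0 = d"
    using has_field_derivative_along_line[of f c 0 z] c by (simp add: d_def DERIV_imp_deriv)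
  moreover have "cmod (deriv (\<lambda>t. f (t *s z)) 0) \<le> 1"
    by (intro cmod_deriv_0_le_1 diff bound line)
  ultimately have "cmod d \<le> 1" by simp
  then show "cmod (\<Sum>i\<in>UNIV. (\<chi> i. pderiv0 f i) $ i * z $ i) \<le> 1"
    using pderiv0_eq[OF c] by (simp add: d_def)
qed

section \<open>The equivalence of the four conditions\<close>

lemma linmap_norm_le_1_iff:
  fixes A :: "'m::finite \<Rightarrow> complex^'n::finite^'n"
    and V :: "'m \<Rightarrow> complex^'q::finite^'p::finite"
  assumes "lin_indep A"
  shows "linmap_norm (dual_normA A) (pencil V) \<le> 1 \<longleftrightarrow>
    (\<forall>\<alpha> \<beta>. norm \<alpha> = 1 \<longrightarrow> norm \<beta> = 1 \<longrightarrow> opnorm (pencil V (\<chi> i. hinner (A i *v \<alpha>) \<beta>)) \<le> 1)"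
    (is "?L \<longleftrightarrow> ?R")
proof
  assume L: ?L
  show ?R
  proof (intro allI impI)
    fix \<alpha> \<beta> :: "complex^'n"
    assume unit: "norm \<alpha> = 1" "norm \<beta> = 1"
    \<comment> \<open>The coefficient vector of \<open>pA A \<alpha> \<beta>\<close> lies in the
      dual unit ball because \<open>pA\<close> is dominated by \<open>normA\<close>.\<close>
    have "dual_normA A (\<chi> i. hinner (A i *v \<alpha>) \<beta>) \<le> 1"
      using order_trans[OF cmod_pA_le[OF unit, of A]]
      by (intro dual_normA_le) (simp add: pA_eq)
    then show "opnorm (pencil V (\<chi> i. hinner (A i *v \<alpha>) \<beta>)) \<le> 1"
      using L by (auto simp: linmap_norm_def SUP_le_iff)
  qed
next
  assume R: ?R
  have "opnorm (pencil V l) \<le> 1" if l: "dual_normA A l \<le> 1" for l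
  proof (rule opnorm_le_hinner)
    fix x :: "complex^'q" and y :: "complex^'p"
    assume xy: "norm x = 1" "norm y = 1"
    \<comment> \<open>Pairing \<open>l\<close> with \<open>w\<close> gives
      \<open>hinner (pencil V l *v x) y\<close>, so it remains to place \<open>w\<close> in the unit
      ball of \<open>normA A\<close>.\<close>
    define w where "w = (\<chi> i. hinner (V i *v x) y)"
    have "normA A w \<le> 1"
      unfolding normA_def
    proof (rule opnorm_le_hinner)
      fix \<alpha> \<beta> :: "complex^'n"
      assume "norm \<alpha> = 1" "norm \<beta> = 1"
      then have "opnorm (pencil V (\<chi> i. hinner (A i *v \<alpha>) \<beta>)) \<le> 1" using R by blast
      \<comment> \<open>Both sides are the sum over \<open>i\<close> of
        \<open>hinner (V i *v x) y * hinner (A i *v \<alpha>) \<beta>\<close>, which is symmetric in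
        the two tuples.\<close>
      moreover have "hinner (pencil A w *v \<alpha>) \<beta> =
          hinner (pencil V (\<chi> i. hinner (A i *v \<alpha>) \<beta>) *v x) y"
        by (simp add: hinner_pencil w_def mult.commute)
      ultimately show "cmod (hinner (pencil A w *v \<alpha>) \<beta>) \<le> 1"
        using cmod_hinner_le_opnorm[OF xy, of "pencil V (\<chi> i. hinner (A i *v \<alpha>) \<beta>)"] by simp
    qed simp
    then have "cmod (\<Sum>i\<in>UNIV. l $ i * w $ i) \<le> 1"
      using cmod_pairing_le_dual_normA[OF assms] l order_trans by blast
    then show "cmod (hinner (pencil V l *v x) y) \<le> 1"
      by (simp add: hinner_pencil w_def)
  qed simp
  then show ?L by (auto simp: linmap_norm_def SUP_le_iff)
qed

theorem proposition1p2:
  fixes A :: "'m::finite \<Rightarrow> complex^'n::finite^'n"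
    and V :: "'m \<Rightarrow> complex^'q::finite^'p::finite"
  assumes "lin_indep A"
  shows "(rho_norm A V \<le> 1 \<longleftrightarrow>
           (SUP (\<alpha>, \<beta>)\<in>{(\<alpha>, \<beta>). norm \<alpha> = 1 \<and> norm \<beta> = 1}.
              ereal (opnorm (rho V (pA A \<alpha> \<beta>)))) \<le> 1)
       \<and> ((SUP (\<alpha>, \<beta>)\<in>{(\<alpha>, \<beta>). norm \<alpha> = 1 \<and> norm \<beta> = 1}.
              ereal (opnorm (rho V (pA A \<alpha> \<beta>)))) \<le> 1 \<longleftrightarrow>
           linmap_norm (dual_normA A) (pencil V) \<le> 1)
       \<and> (linmap_norm (dual_normA A) (pencil V) \<le> 1 \<longleftrightarrow>
           (SUP (\<alpha>, \<beta>)\<in>{(\<alpha>, \<beta>). norm \<alpha> = 1 \<and> norm \<beta> = 1}.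
              ereal (opnorm (pencil V (\<chi> i. hinner (A i *v \<alpha>) \<beta>)))) \<le> 1)"
proof -
  \<comment> \<open>The pointwise form of the last condition; each of the four conditions is shown
    equivalent to it.\<close>
  let ?P = "\<forall>\<alpha> \<beta>. norm \<alpha> = 1 \<longrightarrow> norm \<beta> = 1 \<longrightarrow>
    opnorm (pencil V (\<chi> i. hinner (A i *v \<alpha>) \<beta>)) \<le> 1"
  let ?ii = "(SUP (\<alpha>, \<beta>)\<in>{(\<alpha>, \<beta>). norm \<alpha> = 1 \<and> norm \<beta> = 1}.
    ereal (opnorm (rho V (pA A \<alpha> \<beta>))))"
  let ?iv = "(SUP (\<alpha>, \<beta>)\<in>{(\<alpha>, \<beta>). norm \<alpha> = 1 \<and> norm \<beta> = 1}.
    ereal (opnorm (pencil V (\<chi> i. hinner (A i *v \<alpha>) \<beta>))))"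
  have iv: "?iv \<le> 1 \<longleftrightarrow> ?P"
    by (auto simp: SUP_le_iff)
  have ii: "?ii \<le> 1 \<longleftrightarrow> ?P"
    by (auto simp: SUP_le_iff opnorm_rho_pA)
  note iii = linmap_norm_le_1_iff[OF assms, of V]
  have i: "rho_norm A V \<le> 1 \<longleftrightarrow> ?P"
  proof
    assume rho: "rho_norm A V \<le> 1"
    show ?P
    proof (intro allI impI)
      fix \<alpha> \<beta> :: "complex^'n"
      assume unit: "norm \<alpha> = 1" "norm \<beta> = 1"
      have "supnorm A (pA A \<alpha> \<beta>) \<le> 1"
        unfolding supnorm_def
      proof (rule SUP_least)
        fix z assume "z \<in> Omega A"
        then show "ereal (cmod (pA A \<alpha> \<beta> z)) \<le> 1"
          using cmod_pA_le[OF unit, of A z] by (simp add: Omega_def)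
      qed
      moreover have "pA A \<alpha> \<beta> 0 = 0" by (simp add: pA_eq)
      ultimately have "ereal (opnorm (rho V (pA A \<alpha> \<beta>))) \<le> 1"
        using rho pA_in_O_alg[of A \<alpha> \<beta>] by (auto simp: rho_norm_def SUP_le_iff)
      then show "opnorm (pencil V (\<chi> i. hinner (A i *v \<alpha>) \<beta>)) \<le> 1"
        by (simp add: opnorm_rho_pA)
    qed
  next
    assume ?P
    \<comment> \<open>By \<open>iii\<close> the bound extends from the coefficient vectors of the
      \<open>pA\<close> to the whole dual unit ball, which contains the gradient at 0 of every
      admissible \<open>f\<close>.\<close>
    then have "opnorm (pencil V l) \<le> 1" if "dual_normA A l \<le> 1" for l
      using iii that by (auto simp: linmap_norm_def SUP_le_iff)
    then show "rho_norm A V \<le> 1"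
      using dual_normA_derivative_le
      by (auto simp: rho_norm_def SUP_le_iff opnorm_rho)
  qed
  show ?thesis by (simp only: i ii iii iv simp_thms)
qed

end
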